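(* Let $\delta=\delta(s)$ be a helix in $\mathrm{E}^4$ with Frenet apparatus $\{T,N,B,E,\kappa,\tau,\sigma\}$, and let $\xi=\xi(s)$ be an involute of $\delta$, with arclength parameter $s_\xi$ and involute constant $c$. Then the Frenet apparatus $\{T_\xi,N_\xi,B_\xi,E_\xi,\kappa_\xi,\tau_\xi,\sigma_\xi\}$ of $\xi$ can be formed by the Frenet apparatus of $\delta$ and takes the following form: $$T_\xi=N,\quad N_\xi=\frac{-\kappa T+\tau B}{\sqrt{\kappa^2+\tau^2}},\quad B_\xi=-E,\quad E_\xi=\frac{\tau T+\kappa B}{\sqrt{\kappa^2+\tau^2}},$$ and $$\kappa_\xi=\frac{\sqrt{\kappa^2+\tau^2}}{\kappa\,|c-s|},\quad \tau_\xi=\frac{\tau\,\sigma}{\kappa\sqrt{\kappa^2+\tau^2}\,|c-s|},\quad \sigma_\xi=-\frac{\sigma}{\sqrt{\kappa^2+\tau^2}\,|c-s|},$$ where $\frac{ds_\xi}{ds}=\kappa\,|c-s|$.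
   Context: $\mathrm{E}^4$ is $\mathbb{R}^4$ with its standard inner product. The moving frame $\{T,N,B,E\}$ (tangent, normal, binormal, trinormal) and the first, second and third curvatures $\kappa,\tau,\sigma$ of a unit speed curve with arclength parameter $s$ satisfy the Frenet-Serret formulas $T'=\kappa N$, $N'=-\kappa T+\tau B$, $B'=-\tau N+\sigma E$, $E'=-\sigma B$. A helix (W-curve) in $\mathrm{E}^4$ is a curve whose curvatures $\kappa,\tau,\sigma$ are non-vanishing constants. An involute of $\delta$ is a curve $\xi(s)=\delta(s)+(c-s)T(s)$ with $c$ a constant. The vector product in $\mathrm{E}^4$ is $a\wedge b\wedge c=\det\begin{pmatrix} e_1&e_2&e_3&e_4\\ a_1&a_2&a_3&a_4\\ b_1&b_2&b_3&b_4\\ c_1&c_2&c_3&c_4\end{pmatrix}$ with $e_i$ the coordinate direction vectors. The Frenet apparatus of an arbitrary regular curve $\xi$ (not necessarily unit speed, primes denoting derivatives with respect to its parameter) is given by $$T_\xi=\frac{\xi'}{\|\xi'\|},\quad N_\xi=\frac{\|\xi'\|^2\xi''-\langle\xi',\xi''\rangle\xi'}{\big\|\|\xi'\|^2\xi''-\langle\xi',\xi''\rangle\xi'\big\|},\quad E_\xi=\mu\frac{T_\xi\wedge N_\xi\wedge\xi'''}{\|T_\xi\wedge N_\xi\wedge\xi'''\|},\quad B_\xi=\mu\,E_\xi\wedge T_\xi\wedge N_\xi,$$ $$\kappa_\xi=\frac{\big\|\|\xi'\|^2\xi''-\langle\xi',\xi''\rangle\xi'\big\|}{\|\xi'\|^4},\quad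 \tau_\xi=\frac{\|T_\xi\wedge N_\xi\wedge\xi'''\|\,\|\xi'\|}{\big\|\|\xi'\|^2\xi''-\langle\xi',\xi''\rangle\xi'\big\|},\quad \sigma_\xi=\frac{\langle\xi^{(IV)},E_\xi\rangle}{\|T_\xi\wedge N_\xi\wedge\xi'''\|\,\|\xi'\|},$$ where $\mu\in\{-1,1\}$ is chosen so that $\det[T_\xi,N_\xi,B_\xi,E_\xi]=1$.
   Formalization: For s≠c, T_ξ and N_ξ carry the factor sgn(c−s), B_ξ and E_ξ carry sgn(c−s)·sgn(τσ), and τ_ξ has |τσ| in place of τσ, since the displayed formulas fail for s>c or τσ<0; they hold as displayed when s<c and τσ>0. *)

theory Defs
  imports "HOL-Analysis.Analysis"
begin

definition det_rows :: "real^4 \<Rightarrow> real^4 \<Rightarrow> real^4 \<Rightarrow> real^4 \<Rightarrow> real" where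
  "det_rows a b c d = det (vector [a, b, c, d] :: real^4^4)"

text \<open>The vector product of three vectors: the formal determinant whose first row consists of the
  coordinate vectors has \<open>i\<close>-th component the determinant with first row \<open>axis i 1\<close>.\<close>

definition wedge3 :: "real^4 \<Rightarrow> real^4 \<Rightarrow> real^4 \<Rightarrow> real^4" where
  "wedge3 a b c = (\<chi> i. det_rows (axis i 1) a b c)"

definition vderiv :: "nat \<Rightarrow> (real \<Rightarrow> real^4) \<Rightarrow> real \<Rightarrow> real^4" where
  "vderiv k f = ((\<lambda>g t. vector_derivative g (at t)) ^^ k) f"


subsection \<open>Frenet apparatus of a regular curve in an arbitrary parameter\<close>

definition frenet_T :: "(real \<Rightarrow> real^4) \<Rightarrow> real \<Rightarrow> real^4" where
  "frenet_T f t = vderiv 1 f t /\<^sub>R norm (vderiv 1 f t)"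

definition normal_numerator :: "(real \<Rightarrow> real^4) \<Rightarrow> real \<Rightarrow> real^4" where
  "normal_numerator f t =
     (norm (vderiv 1 f t))\<^sup>2 *\<^sub>R vderiv 2 f t - (vderiv 1 f t \<bullet> vderiv 2 f t) *\<^sub>R vderiv 1 f t"

definition frenet_N :: "(real \<Rightarrow> real^4) \<Rightarrow> real \<Rightarrow> real^4" where
  "frenet_N f t = normal_numerator f t /\<^sub>R norm (normal_numerator f t)"

definition trinormal_numerator :: "(real \<Rightarrow> real^4) \<Rightarrow> real \<Rightarrow> real^4" where
  "trinormal_numerator f t = wedge3 (frenet_T f t) (frenet_N f t) (vderiv 3 f t)"

text \<open>The trinormal and the binormal belonging to a given choice of the sign \<open>\<mu>\<close>.\<close>

definition frenet_E_of :: "real \<Rightarrow> (real \<Rightarrow> real^4) \<Rightarrow> real \<Rightarrow> real^4" where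
  "frenet_E_of \<mu> f t = \<mu> *\<^sub>R (trinormal_numerator f t /\<^sub>R norm (trinormal_numerator f t))"

definition frenet_B_of :: "real \<Rightarrow> (real \<Rightarrow> real^4) \<Rightarrow> real \<Rightarrow> real^4" where
  "frenet_B_of \<mu> f t = \<mu> *\<^sub>R wedge3 (frenet_E_of \<mu> f t) (frenet_T f t) (frenet_N f t)"

definition frenet_sign :: "(real \<Rightarrow> real^4) \<Rightarrow> real \<Rightarrow> real" where
  "frenet_sign f t = (THE \<mu>. \<mu> \<in> {-1, 1} \<and>
     det_rows (frenet_T f t) (frenet_N f t) (frenet_B_of \<mu> f t) (frenet_E_of \<mu> f t) = 1)"

definition frenet_E :: "(real \<Rightarrow> real^4) \<Rightarrow> real \<Rightarrow> real^4" where
  "frenet_E f t = frenet_E_of (frenet_sign f t) f t"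

definition frenet_B :: "(real \<Rightarrow> real^4) \<Rightarrow> real \<Rightarrow> real^4" where
  "frenet_B f t = frenet_B_of (frenet_sign f t) f t"

definition frenet_\<kappa> :: "(real \<Rightarrow> real^4) \<Rightarrow> real \<Rightarrow> real" where
  "frenet_\<kappa> f t = norm (normal_numerator f t) / norm (vderiv 1 f t) ^ 4"

definition frenet_\<tau> :: "(real \<Rightarrow> real^4) \<Rightarrow> real \<Rightarrow> real" where
  "frenet_\<tau> f t =
     norm (trinormal_numerator f t) * norm (vderiv 1 f t) / norm (normal_numerator f t)"

definition frenet_\<sigma> :: "(real \<Rightarrow> real^4) \<Rightarrow> real \<Rightarrow> real" where
  "frenet_\<sigma> f t =
     (vderiv 4 f t \<bullet> frenet_E f t) / (norm (trinormal_numerator f t) * norm (vderiv 1 f t))"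


subsection \<open>Unit speed curves, helices and involutes\<close>

text \<open>The moving frame of a unit speed curve: positively oriented, orthonormal, and subject to the
  Frenet-Serret formulas. The first curvature is the norm of \<open>T'\<close>, hence nonnegative; the other two
  are allowed to have either sign. This is not interchangeable with the explicit formulas above:
  as the vector product is oriented by its first row, on a curve with such a frame and with
  positive \<open>\<kappa>\<close>, \<open>\<tau>\<close> and nonzero \<open>\<sigma>\<close> they return \<open>-B\<close>, \<open>-E\<close> and \<open>-\<sigma>\<close>.\<close>

definition frenet_serret_on ::
  "real set \<Rightarrow> (real \<Rightarrow> real^4) \<Rightarrow>
   (real \<Rightarrow> real^4) \<Rightarrow> (real \<Rightarrow> real^4) \<Rightarrow> (real \<Rightarrow> real^4) \<Rightarrow> (real \<Rightarrow> real^4) \<Rightarrow>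
   (real \<Rightarrow> real) \<Rightarrow> (real \<Rightarrow> real) \<Rightarrow> (real \<Rightarrow> real) \<Rightarrow> bool" where
  "frenet_serret_on I \<delta> T N B E \<kappa> \<tau> \<sigma> \<longleftrightarrow> (\<forall>s\<in>I.
     (\<delta> has_vector_derivative T s) (at s) \<and>
     rotation_matrix (vector [T s, N s, B s, E s] :: real^4^4) \<and>
     0 \<le> \<kappa> s \<and>
     (T has_vector_derivative \<kappa> s *\<^sub>R N s) (at s) \<and>
     (N has_vector_derivative - \<kappa> s *\<^sub>R T s + \<tau> s *\<^sub>R B s) (at s) \<and>
     (B has_vector_derivative - \<tau> s *\<^sub>R N s + \<sigma> s *\<^sub>R E s) (at s) \<and>
     (E has_vector_derivative - \<sigma> s *\<^sub>R B s) (at s))"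

definition helix_on ::
  "real set \<Rightarrow> (real \<Rightarrow> real^4) \<Rightarrow>
   (real \<Rightarrow> real^4) \<Rightarrow> (real \<Rightarrow> real^4) \<Rightarrow> (real \<Rightarrow> real^4) \<Rightarrow> (real \<Rightarrow> real^4) \<Rightarrow>
   real \<Rightarrow> real \<Rightarrow> real \<Rightarrow> bool" where
  "helix_on I \<delta> T N B E \<kappa> \<tau> \<sigma> \<longleftrightarrow>
     open I \<and> is_interval I \<and>
     frenet_serret_on I \<delta> T N B E (\<lambda>_. \<kappa>) (\<lambda>_. \<tau>) (\<lambda>_. \<sigma>) \<and>
     \<kappa> \<noteq> 0 \<and> \<tau> \<noteq> 0 \<and> \<sigma> \<noteq> 0"

text \<open>The second argument is the unit tangent field of the first.\<close>

definition involute :: "real \<Rightarrow> (real \<Rightarrow> real^4) \<Rightarrow> (real \<Rightarrow> real^4) \<Rightarrow> real \<Rightarrow> real^4" where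
  "involute c \<delta> T s = \<delta> s + (c - s) *\<^sub>R T s"

text \<open>The domain need not be connected; an arclength parameter is determined up to an additive
  constant on each of its components.\<close>

definition arclength_parameter_on :: "real set \<Rightarrow> (real \<Rightarrow> real^4) \<Rightarrow> (real \<Rightarrow> real) \<Rightarrow> bool" where
  "arclength_parameter_on J f l \<longleftrightarrow> (\<forall>a b. a \<le> b \<longrightarrow> {a..b} \<subseteq> J \<longrightarrow>
     ((\<lambda>u. norm (vderiv 1 f u)) has_integral (l b - l a)) {a..b})"

end

theory Submission
  imports Defs
begin

text \<open>
  The idea is to compute in the moving frame of the helix. Let \<open>F t\<close> be the matrix with rows
  \<open>T t\<close>, \<open>N t\<close>, \<open>B t\<close>, \<open>E t\<close>, so that \<open>x v* F t\<close> is the vector with coordinates \<open>x\<close> in the frame.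
  The Frenet-Serret formulas turn differentiation of such a vector into a linear rule on its
  coordinates (\<open>frame_coordinates_derivative\<close>). Write \<open>r = c - t\<close>. The derivative
  of the involute is \<open>r \<kappa> N\<close>, because the term \<open>- T\<close> coming from the factor \<open>c - t\<close> cancels \<open>\<delta>'\<close>, and
  the rule then gives the next three derivatives (\<open>involute_derivatives\<close>).

  The explicit formulas for the apparatus use only norms, inner products, vector products and
  determinants. A rotation preserves norms, inner products and determinants, and commutes with the
  vector product (\<open>wedge3_vector_matrix\<close>). Hence the apparatus can be evaluated on the coordinate vectors
  (\<open>involute_apparatus\<close>). With \<open>P = - \<kappa> T + \<tau> B\<close> and \<open>Q = \<tau> T + \<kappa> B\<close>, both of length
  \<open>sqrt (\<kappa>\<^sup>2 + \<tau>\<^sup>2)\<close>, the numerator of the principal normal is \<open>(r \<kappa>)\<^sup>3 P\<close> and that of the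
  trinormal is a positive multiple of \<open>r \<tau> \<sigma> Q\<close>. Normalising these leaves the signs of \<open>r\<close> and of \<open>r \<tau> \<sigma>\<close>,
  which is where the signs in the theorem come from. The sign \<open>\<mu>\<close> is 1: by definition
  \<open>B = \<mu> (E \<and> T \<and> N)\<close>, so the determinant that has to be 1 is \<open>\<mu> \<parallel>E \<and> T \<and> N\<parallel>\<^sup>2\<close>
  (\<open>frenet_sign_eq_1\<close>).

  Finally the speed of the involute is \<open>\<kappa> \<bar>c - t\<bar>\<close>, and an arclength parameter has the speed as its
  derivative by the fundamental theorem of calculus.
\<close>

section \<open>The vector product in four dimensions\<close>

lemma det_4:
  "det (A::'a::comm_ring_1^4^4) =
    A$1$1 * (A$2$2 * (A$3$3 * A$4$4 - A$3$4 * A$4$3) - A$2$3 * (A$3$2 * A$4$4 - A$3$4 * A$4$2)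
      + A$2$4 * (A$3$2 * A$4$3 - A$3$3 * A$4$2))
  - A$1$2 * (A$2$1 * (A$3$3 * A$4$4 - A$3$4 * A$4$3) - A$2$3 * (A$3$1 * A$4$4 - A$3$4 * A$4$1)
      + A$2$4 * (A$3$1 * A$4$3 - A$3$3 * A$4$1))
  + A$1$3 * (A$2$1 * (A$3$2 * A$4$4 - A$3$4 * A$4$2) - A$2$2 * (A$3$1 * A$4$4 - A$3$4 * A$4$1)
      + A$2$4 * (A$3$1 * A$4$2 - A$3$2 * A$4$1))
  - A$1$4 * (A$2$1 * (A$3$2 * A$4$3 - A$3$3 * A$4$2) - A$2$2 * (A$3$1 * A$4$3 - A$3$3 * A$4$1)
      + A$2$3 * (A$3$1 * A$4$2 - A$3$2 * A$4$1))"
proof -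
  have f1234: "finite {2::4, 3, 4}" "1 \<notin> {2::4, 3, 4}" by auto
  have f234: "finite {3::4, 4}" "2 \<notin> {3::4, 4}" by auto
  have f34: "finite {4::4}" "3 \<notin> {4::4}" by auto
  show ?thesis
    unfolding det_def UNIV_4
    unfolding sum_over_permutations_insert[OF f1234]
    unfolding sum_over_permutations_insert[OF f234]
    unfolding sum_over_permutations_insert[OF f34]
    unfolding permutes_sing
    by (simp add: sign_swap_id permutation_swap_id permutation_compose sign_compose sign_id
        swap_id_eq) (simp add: algebra_simps)
qed

lemma vector_4 [simp]:
  "(vector [a, b, c, d] :: 'a::zero^4) $ 1 = a"
  "(vector [a, b, c, d] :: 'a::zero^4) $ 2 = b"
  "(vector [a, b, c, d] :: 'a::zero^4) $ 3 = c"
  "(vector [a, b, c, d] :: 'a::zero^4) $ 4 = d"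
  unfolding vector_def by simp_all

lemma row_combination:
  fixes T N B E :: "real^'n"
  shows "vector [a, b, c, d] v* (vector [T, N, B, E] :: real^'n^4)
    = a *\<^sub>R T + b *\<^sub>R N + c *\<^sub>R B + d *\<^sub>R E"
  by (simp add: vector_matrix_mult_def vec_eq_iff sum_4)

lemma inner_vector_matrix_orthogonal:
  fixes R :: "real^'n^'n"
  assumes "orthogonal_matrix R"
  shows "(x v* R) \<bullet> (y v* R) = x \<bullet> y"
  using assms
  by (metis dot_lmul_matrix matrix_vector_mul_assoc matrix_vector_mul_lid orthogonal_matrix_def
      transpose_matrix_vector)

lemma norm_vector_matrix_orthogonal:
  fixes R :: "real^'n^'n"
  assumes "orthogonal_matrix R"
  shows "norm (x v* R) = norm x"
  using assms by (simp add: norm_eq_sqrt_inner inner_vector_matrix_orthogonal)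

lemma det_rows_vector_matrix:
  assumes "det R = 1"
  shows "det_rows (a v* R) (b v* R) (c v* R) (d v* R) = det_rows a b c d"
proof -
  have "(vector [a v* R, b v* R, c v* R, d v* R] :: real^4^4) = vector [a, b, c, d] ** R"
    by (simp add: vec_eq_iff forall_4 vector_matrix_mult_def matrix_matrix_mult_def mult.commute)
  then show ?thesis
    using assms by (simp add: det_rows_def det_mul)
qed

text \<open>
  The coordinate vectors in the first row of the formal determinant are replaced by \<open>x\<close>, since the
  determinant is linear in its first row.
\<close>

lemma inner_wedge3: "x \<bullet> wedge3 a b c = det_rows x a b c"
  by (simp add: inner_vec_def sum_4 wedge3_def det_rows_def det_4 axis_def) (simp add: algebra_simps)

text \<open>
  A rotation preserves determinants and inner products. As \<open>x \<bullet> wedge3 a b c\<close> is a determinant, both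
  sides have the same inner product with every vector of the form \<open>x v* R\<close>, that is with every vector.
\<close>

lemma wedge3_vector_matrix:
  assumes "rotation_matrix R"
  shows "wedge3 (a v* R) (b v* R) (c v* R) = wedge3 a b c v* R"
proof -
  have R: "orthogonal_matrix R" "det R = 1"
    using assms by (auto simp: rotation_matrix_def)
  have "y \<bullet> wedge3 (a v* R) (b v* R) (c v* R) = y \<bullet> (wedge3 a b c v* R)" for y
  proof -
    obtain x where y: "y = x v* R"
      using R(1) by (metis orthogonal_matrix_def vector_matrix_mul_assoc vector_matrix_mul_rid)
    show ?thesis
      unfolding y using R
      by (simp add: inner_wedge3 det_rows_vector_matrix inner_vector_matrix_orthogonal)
  qed
  then show ?thesis
    using vector_eq_ldot by blast
qed

lemma wedge3_scaleR:
  "wedge3 (p *\<^sub>R a) b c = p *\<^sub>R wedge3 a b c"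
  "wedge3 a (p *\<^sub>R b) c = p *\<^sub>R wedge3 a b c"
  "wedge3 a b (p *\<^sub>R c) = p *\<^sub>R wedge3 a b c"
  by (simp_all add: vec_eq_iff forall_4 wedge3_def det_rows_def det_4 axis_def) (simp_all add: algebra_simps)

section \<open>The sign in the Frenet apparatus\<close>

lemma det_rows_swap_pairs: "det_rows a b x y = det_rows x y a b"
  by (simp add: det_rows_def det_4 algebra_simps)

text \<open>
  Moving the last two rows to the front is an even permutation, so the determinant in the definition
  of the sign is \<open>B \<bullet> (E \<and> T \<and> N)\<close>, and \<open>B\<close> is itself \<open>\<mu> (E \<and> T \<and> N)\<close>. As \<open>E\<close> carries one factor
  \<open>\<mu>\<close> as well, the determinant is an odd power of \<open>\<mu>\<close>.
\<close>

lemma frenet_sign_eq_1: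
  assumes "norm (wedge3 (frenet_E_of 1 f t) (frenet_T f t) (frenet_N f t)) = 1"
  shows "frenet_sign f t = 1"
proof -
  let ?W = "wedge3 (frenet_E_of 1 f t) (frenet_T f t) (frenet_N f t)"
  have E: "frenet_E_of \<mu> f t = \<mu> *\<^sub>R frenet_E_of 1 f t" for \<mu>
    by (simp add: frenet_E_of_def)
  have det: "det_rows (frenet_T f t) (frenet_N f t) (frenet_B_of \<mu> f t) (frenet_E_of \<mu> f t) = \<mu> ^ 3"
    for \<mu>
  proof -
    have "det_rows (frenet_T f t) (frenet_N f t) (frenet_B_of \<mu> f t) (frenet_E_of \<mu> f t)
        = frenet_B_of \<mu> f t \<bullet> wedge3 (frenet_E_of \<mu> f t) (frenet_T f t) (frenet_N f t)"
      by (simp only: inner_wedge3 det_rows_swap_pairs[of "frenet_T f t"])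
    also have "\<dots> = \<mu> ^ 3 * (norm ?W)\<^sup>2"
      unfolding frenet_B_of_def E[of \<mu>]
      by (simp only: wedge3_scaleR inner_scaleR_left inner_scaleR_right power2_norm_eq_inner
          power3_eq_cube mult.assoc)
    finally show ?thesis
      by (simp only: assms power_one mult_1_right)
  qed
  show ?thesis
    unfolding frenet_sign_def det by (rule the_equality) auto
qed

section \<open>Differentiation in a moving frame\<close>

text \<open>
  A derivative at \<open>t\<close> depends on the values near \<open>t\<close> only, so it suffices to know the previous
  derivative on an open set. This is what allows curves that are controlled only on \<open>I\<close>.
\<close>

lemma vderiv_Suc:
  assumes "open I" "t \<in> I"
    and "\<And>u. u \<in> I \<Longrightarrow> vderiv k f u = g u"
    and "(g has_vector_derivative g') (at t)"
  shows "vderiv (Suc k) f t = g'"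
proof -
  have "(vderiv k f has_vector_derivative g') (at t)"
    using has_vector_derivative_transform_within_open[OF assms(4,1,2)] assms(3) by simp
  then show ?thesis
    by (simp add: vderiv_def vector_derivative_at)
qed

abbreviation frame ::
  "(real \<Rightarrow> real^4) \<Rightarrow> (real \<Rightarrow> real^4) \<Rightarrow> (real \<Rightarrow> real^4) \<Rightarrow> (real \<Rightarrow> real^4) \<Rightarrow> real \<Rightarrow> real^4^4"
  where "frame T N B E t \<equiv> vector [T t, N t, B t, E t]"

text \<open>
  The product rule: the coordinates change by their own derivatives, and in addition by the
  skew-symmetric matrix of curvatures that expresses the derivatives of the frame.
\<close>

lemma frame_coordinates_derivative:
  assumes fs: "frenet_serret_on I \<delta> T N B E \<kappa> \<tau> \<sigma>" and t: "t \<in> I"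
    and "(a has_real_derivative a') (at t)" "(b has_real_derivative b') (at t)"
    and "(c has_real_derivative c') (at t)" "(d has_real_derivative d') (at t)"
  shows "((\<lambda>t. vector [a t, b t, c t, d t] v* frame T N B E t) has_vector_derivative
    vector [a' - \<kappa> t * b t, b' + \<kappa> t * a t - \<tau> t * c t, c' + \<tau> t * b t - \<sigma> t * d t,
      d' + \<sigma> t * c t] v* frame T N B E t) (at t)"
proof -
  have TNBE: "(T has_vector_derivative \<kappa> t *\<^sub>R N t) (at t)"
    "(N has_vector_derivative - \<kappa> t *\<^sub>R T t + \<tau> t *\<^sub>R B t) (at t)"
    "(B has_vector_derivative - \<tau> t *\<^sub>R N t + \<sigma> t *\<^sub>R E t) (at t)"
    "(E has_vector_derivative - \<sigma> t *\<^sub>R B t) (at t)"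
    using fs t by (auto simp: frenet_serret_on_def)
  show ?thesis
    unfolding row_combination
    by (rule has_vector_derivative_eq_rhs, (rule has_vector_derivative_add has_vector_derivative_scaleR TNBE assms)+)
       (simp add: algebra_simps)
qed

text \<open>
  The new coordinates are tied to the derivatives by equations, so that they can be given in
  simplified form at each step.
\<close>

lemma vderiv_Suc_in_frame:
  assumes fs: "frenet_serret_on I \<delta> T N B E \<kappa> \<tau> \<sigma>" and "open I" "t \<in> I"
    and k: "\<And>u. u \<in> I \<Longrightarrow> vderiv k f u = vector [a u, b u, c u, d u] v* frame T N B E u"
    and deriv: "(a has_real_derivative a') (at t)" "(b has_real_derivative b') (at t)"
      "(c has_real_derivative c') (at t)" "(d has_real_derivative d') (at t)"
    and "w = a' - \<kappa> t * b t" "x = b' + \<kappa> t * a t - \<tau> t * c t"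
      "y = c' + \<tau> t * b t - \<sigma> t * d t" "z = d' + \<sigma> t * c t"
  shows "vderiv (Suc k) f t = vector [w, x, y, z] v* frame T N B E t"
  unfolding assms(9-)
  by (rule vderiv_Suc[OF assms(2,3) k frame_coordinates_derivative[OF fs assms(3) deriv]])

text \<open>
  On a small interval \<open>{a..b}\<close> around \<open>t\<close> the parameter \<open>l\<close> is a constant plus the integral of the
  speed from \<open>a\<close>, so the fundamental theorem of calculus applies.
\<close>

lemma arclength_parameter_has_derivative:
  assumes l: "arclength_parameter_on J f l" and "open J" "t \<in> J"
    and cont: "continuous_on J (\<lambda>u. norm (vderiv 1 f u))"
  shows "(l has_real_derivative norm (vderiv 1 f t)) (at t)"
proof -
  obtain e where e: "e > 0" "cball t e \<subseteq> J"
    using assms(2,3) open_contains_cball by blast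
  define a b where "a = t - e" and "b = t + e"
  have ab: "a < t" "t < b" "{a..b} \<subseteq> J"
    using e by (auto simp: a_def b_def cball_eq_atLeastAtMost)
  let ?v = "\<lambda>u. norm (vderiv 1 f u)"
  have "((\<lambda>u. integral {a..u} ?v) has_real_derivative ?v t) (at t within {a..b})"
    using ab by (intro integral_has_real_derivative continuous_on_subset[OF cont]) auto
  then have "((\<lambda>u. integral {a..u} ?v) has_real_derivative ?v t) (at t)"
    using ab at_within_Icc_at[of a t b] by simp
  then have D: "((\<lambda>u. l a + integral {a..u} ?v) has_real_derivative ?v t) (at t)"
    by (auto intro!: derivative_eq_intros)
  have eq: "l a + integral {a..u} ?v = l u" if "u \<in> {a<..<b}" for u
  proof -
    have "{a..u} \<subseteq> J"
      using that ab(3) by (auto simp: subset_iff)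
    then have "(?v has_integral (l u - l a)) {a..u}"
      using l[unfolded arclength_parameter_on_def, rule_format, of a u] that by simp
    then show ?thesis by (simp add: integral_unique)
  qed
  show ?thesis
    by (rule has_field_derivative_transform_within_open[OF D, of "{a<..<b}"]) (use ab eq in simp_all)
qed

section \<open>The involute of a helix\<close>

text \<open>
  Differentiating \<open>\<delta> + (c - t) T\<close> gives \<open>T - T + (c - t) \<kappa> N\<close>; each further derivative is one
  application of the coordinate rule.
\<close>

lemma involute_derivatives:
  fixes c :: real
  assumes helix: "helix_on I \<delta> T N B E \<kappa> \<tau> \<sigma>" and t: "t \<in> I"
  defines "\<xi> \<equiv> involute c \<delta> T"
  shows "vderiv 1 \<xi> t = vector [0, (c - t) * \<kappa>, 0, 0] v* frame T N B E t" (is ?D1)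
    and "vderiv 2 \<xi> t = vector [- (c - t) * \<kappa>\<^sup>2, - \<kappa>, (c - t) * \<kappa> * \<tau>, 0] v* frame T N B E t" (is ?D2)
    and "vderiv 3 \<xi> t = vector [2 * \<kappa>\<^sup>2, - (c - t) * \<kappa> * (\<kappa>\<^sup>2 + \<tau>\<^sup>2), - 2 * \<kappa> * \<tau>,
      (c - t) * \<kappa> * \<tau> * \<sigma>] v* frame T N B E t" (is ?D3)
    and "vderiv 4 \<xi> t = vector [(c - t) * \<kappa>\<^sup>2 * (\<kappa>\<^sup>2 + \<tau>\<^sup>2), 3 * \<kappa> * (\<kappa>\<^sup>2 + \<tau>\<^sup>2),
      - (c - t) * \<kappa> * \<tau> * (\<kappa>\<^sup>2 + \<tau>\<^sup>2 + \<sigma>\<^sup>2), - 3 * \<kappa> * \<tau> * \<sigma>] v* frame T N B E t" (is ?D4)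
proof -
  have I: "open I" and fs: "frenet_serret_on I \<delta> T N B E (\<lambda>_. \<kappa>) (\<lambda>_. \<tau>) (\<lambda>_. \<sigma>)"
    using helix by (auto simp: helix_on_def)
  have D1: "vderiv 1 \<xi> u = vector [0, (c - u) * \<kappa>, 0, 0] v* frame T N B E u" if u: "u \<in> I" for u
  proof -
    have "(\<delta> has_vector_derivative T u) (at u)" "(T has_vector_derivative \<kappa> *\<^sub>R N u) (at u)"
      using fs u by (auto simp: frenet_serret_on_def)
    then have "(\<xi> has_vector_derivative vector [0, (c - u) * \<kappa>, 0, 0] v* frame T N B E u) (at u)"
      unfolding \<xi>_def involute_def[abs_def] row_combination
      by (auto intro!: derivative_eq_intros has_vector_derivative_eq_rhs
        [OF has_vector_derivative_add[OF _ has_vector_derivative_scaleR]])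
    then show ?thesis
      by (simp add: vderiv_def vector_derivative_at)
  qed
  have D2: "vderiv (Suc 1) \<xi> u
      = vector [- (c - u) * \<kappa>\<^sup>2, - \<kappa>, (c - u) * \<kappa> * \<tau>, 0] v* frame T N B E u" if u: "u \<in> I" for u
    by (rule vderiv_Suc_in_frame[OF fs I u D1, where a' = 0 and b' = "- \<kappa>" and c' = 0 and d' = 0])
       (auto intro!: derivative_eq_intros simp: algebra_simps power2_eq_square)
  have D3: "vderiv (Suc (Suc 1)) \<xi> u
      = vector [2 * \<kappa>\<^sup>2, - (c - u) * \<kappa> * (\<kappa>\<^sup>2 + \<tau>\<^sup>2), - 2 * \<kappa> * \<tau>, (c - u) * \<kappa> * \<tau> * \<sigma>]
          v* frame T N B E u" if u: "u \<in> I" for u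
    by (rule vderiv_Suc_in_frame[OF fs I u D2,
          where a' = "\<kappa>\<^sup>2" and b' = 0 and c' = "- \<kappa> * \<tau>" and d' = 0])
       (auto intro!: derivative_eq_intros simp: algebra_simps power2_eq_square)
  have D4: "vderiv (Suc (Suc (Suc 1))) \<xi> u
      = vector [(c - u) * \<kappa>\<^sup>2 * (\<kappa>\<^sup>2 + \<tau>\<^sup>2), 3 * \<kappa> * (\<kappa>\<^sup>2 + \<tau>\<^sup>2),
          - (c - u) * \<kappa> * \<tau> * (\<kappa>\<^sup>2 + \<tau>\<^sup>2 + \<sigma>\<^sup>2), - 3 * \<kappa> * \<tau> * \<sigma>] v* frame T N B E u" if u: "u \<in> I" for u
    by (rule vderiv_Suc_in_frame[OF fs I u D3,
          where a' = 0 and b' = "\<kappa> * (\<kappa>\<^sup>2 + \<tau>\<^sup>2)" and c' = 0 and d' = "- \<kappa> * \<tau> * \<sigma>"])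
       (auto intro!: derivative_eq_intros simp: algebra_simps power2_eq_square)
  show ?D1 ?D2 ?D3 ?D4
    using D1 D2 D3 D4 t by (simp_all add: eval_nat_numeral)
qed

lemma norm_vector_4:
  "norm (vector [a, b, c, d] :: real^4) = sqrt (a\<^sup>2 + b\<^sup>2 + c\<^sup>2 + d\<^sup>2)"
  by (simp add: norm_eq_sqrt_inner inner_vec_def sum_4 power2_eq_square)

lemma scaleR_vector_4:
  "k *\<^sub>R (vector [a, b, c, d] :: real^4) = vector [k * a, k * b, k * c, k * d]"
  by (simp add: vec_eq_iff forall_4)

text \<open>
  The evaluation of the explicit formulas, with the factor \<open>r\<close> in place of \<open>c - t\<close>. The frame enters
  only through a rotation \<open>R\<close>, which preserves norms and inner products and commutes with the vector
  product.
\<close>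

lemma involute_apparatus:
  fixes \<kappa> \<tau> \<sigma> r :: real and f :: "real \<Rightarrow> real^4"
  assumes R: "rotation_matrix R" and pos: "\<kappa> > 0" "\<tau> \<noteq> 0" "\<sigma> \<noteq> 0" "r \<noteq> 0"
    and D1: "vderiv 1 f t = vector [0, r * \<kappa>, 0, 0] v* R"
    and D2: "vderiv 2 f t = vector [- r * \<kappa>\<^sup>2, - \<kappa>, r * \<kappa> * \<tau>, 0] v* R"
    and D3: "vderiv 3 f t = vector [2 * \<kappa>\<^sup>2, - r * \<kappa> * (\<kappa>\<^sup>2 + \<tau>\<^sup>2), - 2 * \<kappa> * \<tau>,
      r * \<kappa> * \<tau> * \<sigma>] v* R"
    and D4: "vderiv 4 f t = vector [r * \<kappa>\<^sup>2 * (\<kappa>\<^sup>2 + \<tau>\<^sup>2), 3 * \<kappa> * (\<kappa>\<^sup>2 + \<tau>\<^sup>2),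
      - r * \<kappa> * \<tau> * (\<kappa>\<^sup>2 + \<tau>\<^sup>2 + \<sigma>\<^sup>2), - 3 * \<kappa> * \<tau> * \<sigma>] v* R"
  defines "w \<equiv> sqrt (\<kappa>\<^sup>2 + \<tau>\<^sup>2)"
  shows "frenet_T f t = sgn r *\<^sub>R (vector [0, 1, 0, 0] v* R)"
    and "frenet_N f t = sgn r *\<^sub>R ((vector [- \<kappa>, 0, \<tau>, 0] v* R) /\<^sub>R w)"
    and "frenet_B f t = (sgn r * sgn (\<tau> * \<sigma>)) *\<^sub>R (vector [0, 0, 0, - 1] v* R)"
    and "frenet_E f t = (sgn r * sgn (\<tau> * \<sigma>)) *\<^sub>R ((vector [\<tau>, 0, \<kappa>, 0] v* R) /\<^sub>R w)"
    and "frenet_\<kappa> f t = w / (\<kappa> * \<bar>r\<bar>)"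
    and "frenet_\<tau> f t = \<bar>\<tau> * \<sigma>\<bar> / (\<kappa> * w * \<bar>r\<bar>)"
    and "frenet_\<sigma> f t = - (\<sigma> / (w * \<bar>r\<bar>))"
proof -
  have orth: "orthogonal_matrix R"
    using R by (simp add: rotation_matrix_def)
  note norm_R = norm_vector_matrix_orthogonal[OF orth]
  note inner_R = inner_vector_matrix_orthogonal[OF orth]
  have w: "w > 0" "w\<^sup>2 = \<kappa>\<^sup>2 + \<tau>\<^sup>2"
    using pos by (auto simp: w_def add_pos_nonneg)
  let ?P = "vector [- \<kappa>, 0, \<tau>, 0] v* R" and ?Q = "vector [\<tau>, 0, \<kappa>, 0] v* R"
  have PQ: "norm ?P = w" "norm ?Q = w"
    by (simp_all add: norm_R norm_vector_4 w_def add.commute)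
  have w_cancel: "inverse w * (inverse w * w\<^sup>2) = 1"
    using w(1) by (simp add: field_simps power2_eq_square)
  have sgn: "sgn r * (sgn r * x) = x" for x
    using pos by (simp add: sgn_if)

  have speed: "norm (vderiv 1 f t) = \<kappa> * \<bar>r\<bar>"
    unfolding D1 norm_R using pos by (simp add: norm_vector_4 abs_mult)
  show T: "frenet_T f t = sgn r *\<^sub>R (vector [0, 1, 0, 0] v* R)"
    unfolding frenet_T_def speed unfolding D1 scaleR_vector_matrix_assoc[symmetric] scaleR_vector_4
    using pos by (simp add: sgn_div_norm field_simps)
  have num: "normal_numerator f t = (r * \<kappa>) ^ 3 *\<^sub>R ?P"
    unfolding normal_numerator_def speed unfolding D1 D2 inner_R
      scaleR_vector_matrix_assoc[symmetric] vector_matrix_mult_diff_distrib[symmetric]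
    by (rule arg_cong[where f = "\<lambda>v. v v* R"])
       (simp add: vec_eq_iff forall_4 inner_vec_def sum_4 power_mult_distrib power2_eq_square
          power3_eq_cube algebra_simps)
  then have norm_num: "norm (normal_numerator f t) = (\<kappa> * \<bar>r\<bar>) ^ 3 * w"
    using pos by (simp add: PQ power_abs abs_mult mult.commute)
  show N: "frenet_N f t = sgn r *\<^sub>R (?P /\<^sub>R w)"
    unfolding frenet_N_def norm_num unfolding num
    using pos w(1) by (simp add: sgn_if field_simps)
  (* The part of the third derivative along P lies in the span of the two other factors, as does its
     part along N; only the component along the last frame vector contributes. *)
  have tri: "trinormal_numerator f t = (r * \<kappa> * \<tau> * \<sigma> / w) *\<^sub>R ?Q"
  proof -
    have "wedge3 (vector [0, 1, 0, 0]) (vector [- \<kappa>, 0, \<tau>, 0])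
        (vector [2 * \<kappa>\<^sup>2, - r * \<kappa> * (\<kappa>\<^sup>2 + \<tau>\<^sup>2), - 2 * \<kappa> * \<tau>, r * \<kappa> * \<tau> * \<sigma>])
        = (r * \<kappa> * \<tau> * \<sigma>) *\<^sub>R vector [\<tau>, 0, \<kappa>, 0]"
      by (simp add: vec_eq_iff forall_4 wedge3_def det_rows_def det_4 axis_def power2_eq_square)
    then show ?thesis
      unfolding trinormal_numerator_def T N D3 wedge3_scaleR wedge3_vector_matrix[OF R]
      by (simp add: scaleR_vector_matrix_assoc divide_inverse sgn mult.commute)
  qed
  then have norm_tri: "norm (trinormal_numerator f t) = \<kappa> * \<bar>r\<bar> * \<bar>\<tau> * \<sigma>\<bar>"
    using pos w(1) by (simp add: PQ abs_mult)
  have E1: "frenet_E_of 1 f t = (sgn r * sgn (\<tau> * \<sigma>)) *\<^sub>R (?Q /\<^sub>R w)"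
    unfolding frenet_E_of_def norm_tri unfolding tri
    using pos w(1) by (simp add: sgn_if abs_if field_simps)
  have W: "wedge3 (frenet_E_of 1 f t) (frenet_T f t) (frenet_N f t)
      = (sgn r * sgn (\<tau> * \<sigma>)) *\<^sub>R (vector [0, 0, 0, - 1] v* R)"
  proof -
    have "wedge3 (vector [\<tau>, 0, \<kappa>, 0]) (vector [0, 1, 0, 0]) (vector [- \<kappa>, 0, \<tau>, 0])
        = w\<^sup>2 *\<^sub>R vector [0, 0, 0, - 1]"
      unfolding w(2)
      by (simp add: vec_eq_iff forall_4 wedge3_def det_rows_def det_4 axis_def power2_eq_square)
    then show ?thesis
      unfolding E1 T N wedge3_scaleR wedge3_vector_matrix[OF R]
      by (simp add: scaleR_vector_matrix_assoc sgn w_cancel)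
  qed
  have "norm (wedge3 (frenet_E_of 1 f t) (frenet_T f t) (frenet_N f t)) = 1"
    unfolding W using pos by (simp add: norm_R norm_vector_4 abs_mult)
  then have sign: "frenet_sign f t = 1"
    by (rule frenet_sign_eq_1)
  show E: "frenet_E f t = (sgn r * sgn (\<tau> * \<sigma>)) *\<^sub>R (?Q /\<^sub>R w)"
    by (simp add: frenet_E_def sign E1)
  show "frenet_B f t = (sgn r * sgn (\<tau> * \<sigma>)) *\<^sub>R (vector [0, 0, 0, - 1] v* R)"
    by (simp add: frenet_B_def frenet_B_of_def sign W)
  show "frenet_\<kappa> f t = w / (\<kappa> * \<bar>r\<bar>)"
    unfolding frenet_\<kappa>_def norm_num speed
    using pos w(1) by (simp add: field_simps eval_nat_numeral)
  show "frenet_\<tau> f t = \<bar>\<tau> * \<sigma>\<bar> / (\<kappa> * w * \<bar>r\<bar>)"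
    unfolding frenet_\<tau>_def norm_num norm_tri speed
    using pos w(1) by (simp add: field_simps eval_nat_numeral)
  have "vderiv 4 f t \<bullet> ?Q = - r * \<kappa>\<^sup>2 * \<tau> * \<sigma>\<^sup>2"
    unfolding D4 inner_R by (simp add: inner_vec_def sum_4 power2_eq_square algebra_simps)
  then have "vderiv 4 f t \<bullet> frenet_E f t = - \<bar>r\<bar> * \<kappa>\<^sup>2 * \<bar>\<tau> * \<sigma>\<bar> * \<sigma> / w"
    unfolding E by (simp add: abs_sgn divide_inverse power2_eq_square mult_ac)
  then show "frenet_\<sigma> f t = - (\<sigma> / (w * \<bar>r\<bar>))"
    unfolding frenet_\<sigma>_def norm_tri speed
    using pos w(1) by (simp add: divide_simps) (simp add: power2_eq_square)
qed

theorem theorem5p1: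
  fixes I :: "real set"
    and \<delta> \<xi> T N B E :: "real \<Rightarrow> real^4"
    and \<kappa> \<tau> \<sigma> c s :: real
    and s\<^sub>\<xi> :: "real \<Rightarrow> real"
  assumes helix: "helix_on I \<delta> T N B E \<kappa> \<tau> \<sigma>"
    and involute: "\<xi> = involute c \<delta> T"
    and arclength: "arclength_parameter_on (I - {c}) \<xi> s\<^sub>\<xi>"
    and s: "s \<in> I" "s \<noteq> c"
  shows "(s\<^sub>\<xi> has_real_derivative \<kappa> * \<bar>c - s\<bar>) (at s) \<and>
    frenet_T \<xi> s = sgn (c - s) *\<^sub>R N s \<and>
    frenet_N \<xi> s = sgn (c - s) *\<^sub>R ((- \<kappa> *\<^sub>R T s + \<tau> *\<^sub>R B s) /\<^sub>R sqrt (\<kappa>\<^sup>2 + \<tau>\<^sup>2)) \<and>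
    frenet_B \<xi> s = (sgn (c - s) * sgn (\<tau> * \<sigma>)) *\<^sub>R (- E s) \<and>
    frenet_E \<xi> s =
      (sgn (c - s) * sgn (\<tau> * \<sigma>)) *\<^sub>R ((\<tau> *\<^sub>R T s + \<kappa> *\<^sub>R B s) /\<^sub>R sqrt (\<kappa>\<^sup>2 + \<tau>\<^sup>2)) \<and>
    frenet_\<kappa> \<xi> s = sqrt (\<kappa>\<^sup>2 + \<tau>\<^sup>2) / (\<kappa> * \<bar>c - s\<bar>) \<and>
    frenet_\<tau> \<xi> s = \<bar>\<tau> * \<sigma>\<bar> / (\<kappa> * sqrt (\<kappa>\<^sup>2 + \<tau>\<^sup>2) * \<bar>c - s\<bar>) \<and>
    frenet_\<sigma> \<xi> s = - (\<sigma> / (sqrt (\<kappa>\<^sup>2 + \<tau>\<^sup>2) * \<bar>c - s\<bar>)) \<and>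
    (s < c \<and> 0 < \<tau> * \<sigma> \<longrightarrow>
      frenet_T \<xi> s = N s \<and>
      frenet_N \<xi> s = (- \<kappa> *\<^sub>R T s + \<tau> *\<^sub>R B s) /\<^sub>R sqrt (\<kappa>\<^sup>2 + \<tau>\<^sup>2) \<and>
      frenet_B \<xi> s = - E s \<and>
      frenet_E \<xi> s = (\<tau> *\<^sub>R T s + \<kappa> *\<^sub>R B s) /\<^sub>R sqrt (\<kappa>\<^sup>2 + \<tau>\<^sup>2) \<and>
      frenet_\<kappa> \<xi> s = sqrt (\<kappa>\<^sup>2 + \<tau>\<^sup>2) / (\<kappa> * \<bar>c - s\<bar>) \<and>
      frenet_\<tau> \<xi> s = \<tau> * \<sigma> / (\<kappa> * sqrt (\<kappa>\<^sup>2 + \<tau>\<^sup>2) * \<bar>c - s\<bar>) \<and>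
      frenet_\<sigma> \<xi> s = - (\<sigma> / (sqrt (\<kappa>\<^sup>2 + \<tau>\<^sup>2) * \<bar>c - s\<bar>)))"
proof -
  let ?F = "frame T N B E"
  have fs: "frenet_serret_on I \<delta> T N B E (\<lambda>_. \<kappa>) (\<lambda>_. \<tau>) (\<lambda>_. \<sigma>)" and I: "open I"
    and \<kappa>: "\<kappa> > 0" and nz: "\<tau> \<noteq> 0" "\<sigma> \<noteq> 0"
    using helix s(1) by (force simp: helix_on_def frenet_serret_on_def)+
  have F: "rotation_matrix (?F t)" if "t \<in> I" for t
    using fs that by (simp add: frenet_serret_on_def)
  have cs: "c - s \<noteq> 0"
    using s(2) by simp
  note derivs = involute_derivatives[OF helix, where c = c, folded involute]
  note app = involute_apparatus[OF F[OF s(1)] \<kappa> nz cs derivs[OF s(1)]]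
  have speed: "norm (vderiv 1 \<xi> t) = \<kappa> * \<bar>c - t\<bar>" if "t \<in> I" for t
    using F[OF that] \<kappa> unfolding derivs(1)[OF that]
    by (simp add: rotation_matrix_def norm_vector_matrix_orthogonal norm_vector_4 abs_mult)
  have "continuous_on (I - {c}) (\<lambda>t. \<kappa> * \<bar>c - t\<bar>)"
    by (intro continuous_intros)
  then have "continuous_on (I - {c}) (\<lambda>t. norm (vderiv 1 \<xi> t))"
    by (rule continuous_on_eq) (simp only: speed DiffD1)
  then have "(s\<^sub>\<xi> has_real_derivative norm (vderiv 1 \<xi> s)) (at s)"
    using I s by (intro arclength_parameter_has_derivative[OF arclength]) auto
  then have arc: "(s\<^sub>\<xi> has_real_derivative \<kappa> * \<bar>c - s\<bar>) (at s)"
    by (simp only: speed[OF s(1)])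
  have rows: "vector [0, 1, 0, 0] v* ?F s = N s"
    "vector [- \<kappa>, 0, \<tau>, 0] v* ?F s = - \<kappa> *\<^sub>R T s + \<tau> *\<^sub>R B s"
    "vector [0, 0, 0, - 1] v* ?F s = - E s"
    "vector [\<tau>, 0, \<kappa>, 0] v* ?F s = \<tau> *\<^sub>R T s + \<kappa> *\<^sub>R B s"
    by (simp_all add: row_combination)
  note app = app[unfolded rows]
  have "sgn (c - s) = 1 \<and> sgn (\<tau> * \<sigma>) = 1 \<and> \<bar>\<tau> * \<sigma>\<bar> = \<tau> * \<sigma>" if "s < c \<and> 0 < \<tau> * \<sigma>"
    using that by simp
  then show ?thesis
    using arc app by simp
qed

end
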